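(* Let $d\in\mathbb{N}$. There is a constant $z_d\geq0$ depending only on $d$ such that the following hold. (i) If $X\subset\mathbb{R}^d$ is non-empty, then there is a function $f\in\mathcal{L}(d)$ such that $f\sim\underline{\beta}_X$ with constant $z_d$. (ii) If $f\in\mathcal{L}(d)$, then there exists a non-empty set $X\subset\mathbb{R}^d$ such that $f\sim\underline{\beta}_X$ with constant $z_d$.
   Context: Let $\Delta=\{(u,v)\in\mathbb{R}^2:v\leq u\}$; $\log$ is in base $2$. For a non-empty metric space $X$ (subsets of $\mathbb{R}^d$ carry the Euclidean metric), $B(x,r)$ is the closed ball in $X$, and for $E\subset X$, $P_r(E)$ denotes the maximal cardinality of a subset of $E$ such that distinct points in the subset are at distance strictly larger than $4r$. The infimal two-scale branching function $\underline{\beta}_X\colon\Delta\to[0,\infty]$ is $$\underline{\beta}_X(u,v)=\log\inf_{x\in X}P_{2^{-u}}(B(x,2^{-v})).$$ For $\alpha\geq0$, $\mathcal{L}(\alpha)$ denotes the set of functions $f\colon\Delta\to[0,\infty)$ such that: (1) $f(u,u)=0$ for all $u\geq0$; (2) $f(u,v)\geq f(u,w)+f(w,v)$ for all $v\leq w\leq u$; (3) for all $v$, the function $u\mapsto f(u,v)$ (on $[v,\infty)$) is $\alpha$-Lipschitz. For $f,g\colon\Delta\to[0,\infty)$ and $z\geq0$, we say $f\sim g$ with constant $z$ if for all $0\leq v\leq u$: $f(u,v+z)-z\leq g(u,v)$ whenever $v\leq u-z$; and $g(u,v)\leq f(u,v-z)+z$ whenever $v\geq z$. *)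

theory Defs
  imports "HOL-Analysis.Analysis"
begin

(* The supremum ranges over finite subsets only, because card is 0 on infinite sets.
   It is infinite when E has separated subsets of unbounded size, and in particular
   when E has an infinite one; otherwise it is an attained maximum. *)
definition packing_number :: "real \<Rightarrow> 'a::metric_space set \<Rightarrow> enat" where
  "packing_number r E =
     (SUP S \<in> {S. finite S \<and> S \<subseteq> E \<and> (\<forall>x\<in>S. \<forall>y\<in>S. x \<noteq> y \<longrightarrow> dist x y > 4 * r)}.
        enat (card S))"

(* Base-2 logarithm on extended naturals. The library's log 2 0 is 0, so zero gets its own case;
   it does not arise from packing numbers of non-empty sets. *)
definition log2_enat :: "enat \<Rightarrow> ereal" where
  "log2_enat n =
     (case n of enat k \<Rightarrow> (if k = 0 then - \<infinity> else ereal (log 2 (real k))) | \<infinity> \<Rightarrow> \<infinity>)"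

(* The metric space X is a subset of the ambient type, with the restricted metric, so its closed
   balls are the sets X \<inter> cball x r. *)
definition inf_branching :: "'a::metric_space set \<Rightarrow> real \<Rightarrow> real \<Rightarrow> ereal" where
  "inf_branching X u v =
     log2_enat (INF x\<in>X. packing_number (2 powr (- u)) (X \<inter> cball x (2 powr (- v))))"

(* A function on {(u, v). v \<le> u} is represented by a total function of u and v. Here, and in
   the relation below, it is only evaluated at arguments with v \<le> u. *)
definition branching_class :: "real \<Rightarrow> (real \<Rightarrow> real \<Rightarrow> real) set" where
  "branching_class \<alpha> =
     {f. (\<forall>u v. v \<le> u \<longrightarrow> 0 \<le> f u v) \<and>
         (\<forall>u\<ge>0. f u u = 0) \<and>
         (\<forall>u v w. v \<le> w \<and> w \<le> u \<longrightarrow> f u v \<ge> f u w + f w v) \<and>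
         (\<forall>v. lipschitz_on \<alpha> {v..} (\<lambda>u. f u v))}"

(* Values in ereal, so that the [0, \<infinity>]-valued branching function can be compared without
   truncating infinity. *)
definition branching_sim ::
  "real \<Rightarrow> (real \<Rightarrow> real \<Rightarrow> ereal) \<Rightarrow> (real \<Rightarrow> real \<Rightarrow> ereal) \<Rightarrow> bool" where
  "branching_sim z f g \<longleftrightarrow>
     (\<forall>u v. 0 \<le> v \<and> v \<le> u \<longrightarrow>
        (v \<le> u - z \<longrightarrow> f u (v + z) - ereal z \<le> g u v) \<and>
        (v \<ge> z \<longrightarrow> g u v \<le> f u (v - z) + ereal z))"

end

theory Submission
  imports Defs "HOL-Library.Nat_Bijection"
begin

text \<open>
Write \<open>d\<close> for the dimension and \<open>\<beta>\<close> for the branching function of \<open>X\<close>.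

\<^bold>\<open>From sets to functions.\<close> Put disjoint packings of small balls around the points of a
packing of a large ball: the packing numbers multiply, but the small balls stick out of the
large one, so \<open>\<beta>\<close> is superadditive only up to a shift of its second argument. The shift
disappears if the ball at scale \<open>v\<close> gets the radius \<open>2 powr (- v) - 2 powr (- u)\<close>, because
then the radii telescope: \<open>shrunk_log_count\<close> is superadditive
(\<open>shrunk_log_count_superadditive\<close>) and it lies between \<open>\<beta>\<close> with \<open>v\<close> replaced by \<open>v + 1\<close> and
\<open>\<beta>\<close> itself. What is missing is Lipschitz continuity, since packing numbers jump. The largest
\<open>d\<close>-Lipschitz minorant in the first argument (\<open>lipschitz_minorant\<close>) is still superadditive,
and a grid count shows that it loses only a constant: refining the scale of a packing from
\<open>t\<close> to \<open>u\<close> multiplies its size by at most a constant times \<open>2 powr (d * (u - t))\<close>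
(\<open>log_count_refine\<close>).

\<^bold>\<open>From functions to sets.\<close> Fix \<open>w\<close>. The function \<open>f \<cdot> w\<close> is increasing and \<open>d\<close>-Lipschitz, so
there is a set of points with binary digits in which about \<open>f k w\<close> of the \<open>d * (k - w)\<close>
digits on the levels \<open>w + 1, \<dots>, k\<close> are free and the others vanish. Its diameter is about
\<open>(1/2) ^ w\<close>. It takes about \<open>2 powr f u w\<close> balls of radius \<open>2 powr (- u)\<close> to cover it, and
each of its balls of radius \<open>2 powr (- v)\<close> contains about \<open>2 powr (f u w - f v w)\<close> points
separated at scale \<open>u\<close>, which is at least \<open>2 powr f u v\<close> by superadditivity. The set \<open>X\<close> is
the union of such pieces over all \<open>w\<close>, where the piece \<open>w\<close> is placed at distance about
\<open>2 * (1/2) ^ w\<close> from the origin. The pieces are isolated at their own scale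
(\<open>piece_isolated\<close>), so the piece with \<open>w\<close> near \<open>v\<close> gives the upper bound for the infimum at
\<open>(u, v)\<close>. For the lower bound at a point of the piece \<open>w\<close> the piece itself serves if
\<open>w < v\<close>; otherwise the ball contains the whole piece whose index is slightly above \<open>v\<close>,
since the pieces accumulate at the origin (\<open>branching_set_many_points\<close>).
\<close>

section \<open>Packing numbers\<close>

definition separated :: "real \<Rightarrow> 'a::metric_space set \<Rightarrow> bool" where
  "separated r S \<longleftrightarrow> (\<forall>x\<in>S. \<forall>y\<in>S. x \<noteq> y \<longrightarrow> dist x y > 4 * r)"

lemma separated_subset: "separated r S \<Longrightarrow> T \<subseteq> S \<Longrightarrow> separated r T"
  by (auto simp: separated_def)

lemma separated_antimono: "separated r S \<Longrightarrow> s \<le> r \<Longrightarrow> separated s S"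
  unfolding separated_def by fastforce

lemma packing_number_separated:
  "packing_number r E = (SUP S \<in> {S. finite S \<and> S \<subseteq> E \<and> separated r S}. enat (card S))"
  by (simp add: packing_number_def separated_def)

lemma card_le_packing_number:
  assumes "finite S" "S \<subseteq> E" "separated r S"
  shows "enat (card S) \<le> packing_number r E"
  unfolding packing_number_separated using assms by (auto intro!: SUP_upper)

lemma packing_number_le:
  assumes "\<And>S. finite S \<Longrightarrow> S \<subseteq> E \<Longrightarrow> separated r S \<Longrightarrow> enat (card S) \<le> b"
  shows "packing_number r E \<le> b"
  unfolding packing_number_separated using assms by (auto intro!: SUP_least)

lemma packing_number_mono:
  assumes "E \<subseteq> F" "s \<le> r"
  shows "packing_number r E \<le> packing_number s F"
proof (rule packing_number_le)
  fix S assume "finite S" "S \<subseteq> E" "separated r S"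
  then show "enat (card S) \<le> packing_number s F"
    using assms by (intro card_le_packing_number) (auto intro: separated_antimono)
qed

text \<open>Every number up to the packing number is the size of a separated set, because
  separation passes to subsets. This replaces the supremum by an existential statement that
  does not distinguish finite from infinite packing numbers.\<close>

lemma enat_le_packing_number_iff:
  "enat n \<le> packing_number r E \<longleftrightarrow> (\<exists>S. finite S \<and> S \<subseteq> E \<and> separated r S \<and> card S = n)"
    (is "?L \<longleftrightarrow> ?R")
proof
  assume ?R then show ?L by (auto intro: card_le_packing_number)
next
  assume L: ?L
  have "\<exists>S. finite S \<and> S \<subseteq> E \<and> separated r S \<and> n \<le> card S"
  proof (rule ccontr)
    assume neg: "\<nexists>S. finite S \<and> S \<subseteq> E \<and> separated r S \<and> n \<le> card S"
    then have "n \<noteq> 0" by (auto simp: separated_def)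
    moreover have "packing_number r E \<le> enat (n - 1)"
      using neg by (intro packing_number_le) force
    ultimately show False using L by (metis diff_less enat_ord_simps(1) gr_zeroI less_numeral_extra(1) not_less order_trans)
  qed
  then obtain S where S: "finite S" "S \<subseteq> E" "separated r S" "n \<le> card S" by blast
  then obtain T where "T \<subseteq> S" "card T = n" "finite T" by (meson obtain_subset_with_card_n)
  then show ?R using S separated_subset[OF S(3), of T] by (intro exI[of _ T]) auto
qed

definition min_packing :: "'a::metric_space set \<Rightarrow> real \<Rightarrow> real \<Rightarrow> enat" where
  "min_packing X r R = (INF x\<in>X. packing_number r (X \<inter> cball x R))"

lemma inf_branching_min_packing:
  "inf_branching X u v = log2_enat (min_packing X (2 powr (- u)) (2 powr (- v)))"
  by (simp add: inf_branching_def min_packing_def)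

lemma min_packing_mono: "s \<le> r \<Longrightarrow> R \<le> R' \<Longrightarrow> min_packing X r R \<le> min_packing X s R'"
  unfolding min_packing_def by (intro INF_mono' packing_number_mono) auto

lemma enat_le_min_packing_iff:
  "enat n \<le> min_packing X r R \<longleftrightarrow>
     (\<forall>x\<in>X. \<exists>S. finite S \<and> S \<subseteq> X \<inter> cball x R \<and> separated r S \<and> card S = n)"
  by (simp add: min_packing_def le_INF_iff enat_le_packing_number_iff)

lemma min_packing_ge_1:
  assumes "0 \<le> R"
  shows "1 \<le> min_packing X r R"
  unfolding one_enat_def enat_le_min_packing_iff
proof
  fix x assume "x \<in> X"
  then show "\<exists>S. finite S \<and> S \<subseteq> X \<inter> cball x R \<and> separated r S \<and> card S = 1"
    using assms by (intro exI[of _ "{x}"]) (auto simp: separated_def)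
qed

lemma min_packing_attained:
  assumes "X \<noteq> {}"
  obtains x where "x \<in> X" "min_packing X r R = packing_number r (X \<inter> cball x R)"
proof -
  let ?A = "(\<lambda>x. packing_number r (X \<inter> cball x R)) ` X"
  have "Inf ?A \<in> ?A"
    using assms by (metis (mono_tags, lifting) Inf_enat_def LeastI_ex ex_in_conv image_is_empty)
  then show ?thesis using that by (auto simp: min_packing_def)
qed

text \<open>The union of packings of the balls \<open>cball y R'\<close>, where \<open>y\<close> runs through a packing of
  \<open>cball x R\<close>. Points in different small balls are further apart than \<open>4 * s - 2 * R'\<close>, so
  the factor \<open>4\<close> in the definition of a packing leaves room for radii \<open>R'\<close> up to
  \<open>2 * (s - r)\<close>.\<close>

lemma min_packing_superadditive:
  assumes "0 \<le> r" "0 \<le> R'" "4 * r + 2 * R' \<le> 4 * s"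
    and n: "enat n \<le> min_packing X s R" and m: "enat m \<le> min_packing X r R'"
  shows "enat (n * m) \<le> min_packing X r (R + R')"
  unfolding enat_le_min_packing_iff
proof
  fix x assume "x \<in> X"
  then obtain S where S: "finite S" "S \<subseteq> X \<inter> cball x R" "separated s S" "card S = n"
    using n by (auto simp: enat_le_min_packing_iff)
  have "\<forall>y\<in>S. \<exists>T. finite T \<and> T \<subseteq> X \<inter> cball y R' \<and> separated r T \<and> card T = m"
    using m S by (auto simp: enat_le_min_packing_iff)
  then obtain T where T: "\<And>y. y \<in> S \<Longrightarrow> finite (T y)" "\<And>y. y \<in> S \<Longrightarrow> T y \<subseteq> X \<inter> cball y R'"
      "\<And>y. y \<in> S \<Longrightarrow> separated r (T y)" "\<And>y. y \<in> S \<Longrightarrow> card (T y) = m"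
    by metis
  have far: "dist a b > 4 * r" if "y \<in> S" "y' \<in> S" "y \<noteq> y'" "a \<in> T y" "b \<in> T y'" for y y' a b
  proof -
    have "dist y y' > 4 * s" using S that by (auto simp: separated_def)
    moreover have "dist y a \<le> R'" "dist y' b \<le> R'" using T(2)[OF that(1)] T(2)[OF that(2)] that by auto
    moreover have "dist y y' \<le> dist y a + dist a b + dist y' b"
      by (metis add.commute add_left_mono dist_commute dist_triangle dist_triangle_le)
    ultimately show ?thesis using assms by linarith
  qed
  have disj: "T y \<inter> T y' = {}" if "y \<in> S" "y' \<in> S" "y \<noteq> y'" for y y'
    using far[OF that] assms(1) by fastforce
  have "card (\<Union>y\<in>S. T y) = n * m"
    using S T disj by (subst card_UN_disjoint) auto
  moreover have "separated r (\<Union>y\<in>S. T y)"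
    using far T(3) unfolding separated_def by (metis UN_E)
  moreover have "(\<Union>y\<in>S. T y) \<subseteq> X \<inter> cball x (R + R')"
  proof
    fix a assume "a \<in> (\<Union>y\<in>S. T y)"
    then obtain y where y: "y \<in> S" "a \<in> T y" by auto
    then have "dist x y \<le> R" "dist y a \<le> R'" "a \<in> X" using S T(2)[OF y(1)] by auto
    then show "a \<in> X \<inter> cball x (R + R')" using dist_triangle[of x a y] by auto
  qed
  ultimately show "\<exists>S. finite S \<and> S \<subseteq> X \<inter> cball x (R + R') \<and> separated r S \<and> card S = n * m"
    using S T by (intro exI[of _ "\<Union>y\<in>S. T y"]) auto
qed

lemma log2_enat_mono: "m \<le> n \<Longrightarrow> log2_enat m \<le> log2_enat n"
  by (cases m; cases n) (auto simp: log2_enat_def)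

lemma log2_enat_enat: "0 < n \<Longrightarrow> log2_enat (enat n) = ereal (log 2 (real n))"
  by (simp add: log2_enat_def)

section \<open>Counting separated points in Euclidean space\<close>

lemma norm_le_card_mult:
  fixes x :: "real ^ 'n"
  assumes "\<And>j. \<bar>x $ j\<bar> \<le> b"
  shows "norm x \<le> real CARD('n) * b"
proof -
  have "norm x \<le> (\<Sum>j\<in>UNIV. \<bar>x $ j\<bar>)" by (rule norm_le_l1_cart)
  also have "\<dots> \<le> (\<Sum>j\<in>(UNIV::'n set). b)" using assms by (intro sum_mono) auto
  finally show ?thesis by simp
qed

text \<open>Pigeonhole on a cubic grid instead of a comparison of volumes: cells of side
  \<open>4 * r / d\<close> have diameter at most \<open>4 * r\<close>, so each contains at most one point of \<open>S\<close>.\<close>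

lemma card_separated_le:
  fixes S :: "(real ^ 'n) set"
  assumes "0 < r" "0 \<le> R" "separated r S" "finite S" "S \<subseteq> cball x R"
  shows "real (card S) \<le> (real CARD('n) * R / (2 * r) + 2) ^ CARD('n)"
proof -
  define d where "d = real CARD('n)"
  have d: "d > 0" by (simp add: d_def)
  define s where "s = 4 * r / d"
  have s: "s > 0" using assms d by (simp add: s_def)
  define cell where "cell = (\<lambda>y::real^'n. \<lambda>j. \<lfloor>y $ j / s\<rfloor>)"
  define box where "box = (\<lambda>j. {\<lfloor>(x $ j - R) / s\<rfloor> .. \<lfloor>(x $ j + R) / s\<rfloor>})"
  have "inj_on cell S"
  proof (rule inj_onI, rule ccontr)
    fix y y' assume y: "y \<in> S" "y' \<in> S" "cell y = cell y'" "y \<noteq> y'"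
    have "\<bar>(y - y') $ j\<bar> \<le> s" for j
    proof -
      have "\<lfloor>y $ j / s\<rfloor> = \<lfloor>y' $ j / s\<rfloor>" using y by (simp add: cell_def fun_eq_iff)
      then have "\<bar>y $ j / s - y' $ j / s\<bar> \<le> 1" by linarith
      then have "\<bar>(y $ j - y' $ j) / s\<bar> \<le> 1" by (simp add: diff_divide_distrib)
      then show ?thesis using s by (simp add: abs_divide)
    qed
    then have "dist y y' \<le> d * s" unfolding dist_norm d_def by (rule norm_le_card_mult)
    also have "d * s = 4 * r" using d by (simp add: s_def)
    finally show False using y assms(3) unfolding separated_def by force
  qed
  moreover have "cell ` S \<subseteq> PiE UNIV box"
  proof -
    have "cell y j \<in> box j" if "y \<in> S" for y j
    proof -
      have "\<bar>(x - y) $ j\<bar> \<le> R"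
        using that assms component_le_norm_cart[of "x - y" j] by (force simp: dist_norm)
      then have "(x $ j - R) / s \<le> y $ j / s" "y $ j / s \<le> (x $ j + R) / s"
        using s by (auto intro!: divide_right_mono)
      then show ?thesis by (auto simp: cell_def box_def intro: floor_mono)
    qed
    then show ?thesis by (auto simp: PiE_def)
  qed
  moreover have fin: "finite (PiE UNIV box)" by (intro finite_PiE) (auto simp: box_def)
  ultimately have "card S \<le> card (PiE UNIV box)" by (metis card_inj_on_le)
  then have "real (card S) \<le> (\<Prod>j\<in>UNIV. real (card (box j)))"
    by (simp add: card_PiE flip: of_nat_prod)
  also have "\<dots> \<le> (\<Prod>j\<in>(UNIV::'n set). 2 * R / s + 2)"
  proof (rule prod_mono)
    fix j
    have "(x $ j + R) / s - (x $ j - R) / s = 2 * R / s"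
      by (simp add: add_divide_distrib diff_divide_distrib)
    moreover have "0 \<le> 2 * R / s" using s assms by simp
    ultimately show "0 \<le> real (card (box j)) \<and> real (card (box j)) \<le> 2 * R / s + 2"
      unfolding box_def by simp linarith
  qed
  also have "\<dots> = (d * R / (2 * r) + 2) ^ CARD('n)"
    using d assms by (simp add: s_def field_simps)
  finally show ?thesis by (simp add: d_def)
qed

lemma maximal_separated_covers:
  assumes "finite T" "0 \<le> r"
  obtains S where "S \<subseteq> T" "separated r S" "T \<subseteq> (\<Union>y\<in>S. cball y (4 * r))"
proof -
  let ?F = "{S. S \<subseteq> T \<and> separated r S}"
  have "finite ?F" using assms by auto
  moreover have "?F \<noteq> {}" by (auto simp: separated_def)
  ultimately obtain S where S: "S \<in> ?F" "\<forall>U\<in>?F. S \<subseteq> U \<longrightarrow> S = U"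
    using finite_has_maximal[of ?F] by blast
  have "T \<subseteq> (\<Union>y\<in>S. cball y (4 * r))"
  proof
    fix a assume a: "a \<in> T"
    show "a \<in> (\<Union>y\<in>S. cball y (4 * r))"
    proof (rule ccontr)
      assume neg: "a \<notin> (\<Union>y\<in>S. cball y (4 * r))"
      then have far: "dist y a > 4 * r" if "y \<in> S" for y using that by (auto simp: not_le)
      then have "insert a S \<in> ?F"
        using S a by (auto simp: separated_def dist_commute)
      then have "a \<in> S" using S by blast
      then show False using far[of a] assms by simp
    qed
  qed
  then show ?thesis using S that by blast
qed

text \<open>A maximal coarsely separated subset of \<open>S\<close> has at most \<open>n\<close> elements, and the balls of
  radius \<open>4 * s\<close> around them cover \<open>S\<close>; each of these balls is handled by the grid count.\<close>

lemma packing_number_refine: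
  fixes E :: "(real ^ 'n) set"
  assumes "0 < r" "r \<le> s" "packing_number s E \<le> enat n" "finite S" "S \<subseteq> E" "separated r S"
  shows "real (card S) \<le> real n * ((2 * real CARD('n) + 2) * (s / r)) ^ CARD('n)"
proof -
  let ?K = "((2 * real CARD('n) + 2) * (s / r)) ^ CARD('n)"
  obtain C where C: "C \<subseteq> S" "separated s C" "S \<subseteq> (\<Union>y\<in>C. cball y (4 * s))"
    using maximal_separated_covers[of S s] assms by auto
  have fC: "finite C" using C assms finite_subset by blast
  have "enat (card C) \<le> packing_number s E"
    using C fC assms by (intro card_le_packing_number) auto
  then have n: "card C \<le> n" using assms by (metis enat_ord_simps(1) order_trans)
  have K: "real (card (S \<inter> cball y (4 * s))) \<le> ?K" for y
  proof -
    have "real (card (S \<inter> cball y (4 * s)))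
        \<le> (real CARD('n) * (4 * s) / (2 * r) + 2) ^ CARD('n)"
      using assms by (intro card_separated_le) (auto intro: separated_subset)
    also have "\<dots> \<le> ?K"
      using assms by (intro power_mono add_nonneg_nonneg) (auto simp: field_simps)
    finally show ?thesis .
  qed
  have "card S = card (\<Union>y\<in>C. S \<inter> cball y (4 * s))"
    using C by (intro arg_cong[of _ _ card]) auto
  also have "\<dots> \<le> (\<Sum>y\<in>C. card (S \<inter> cball y (4 * s)))"
    using fC by (rule card_UN_le)
  finally have "real (card S) \<le> (\<Sum>y\<in>C. real (card (S \<inter> cball y (4 * s))))"
    by (metis of_nat_le_iff of_nat_sum)
  also have "\<dots> \<le> (\<Sum>y\<in>C. ?K)" using K by (intro sum_mono) auto
  also have "\<dots> = real (card C) * ?K" by simp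
  also have "\<dots> \<le> real n * ?K" using n assms by (intro mult_right_mono) auto
  finally show ?thesis .
qed

section \<open>Lipschitz regularization of superadditive functions\<close>

text \<open>For \<open>f\<close> increasing in its first argument, as every nonnegative superadditive \<open>f\<close> is,
  this is the largest \<open>\<alpha>\<close>-Lipschitz function of \<open>u\<close> below \<open>f\<close>.\<close>

definition lipschitz_minorant :: "real \<Rightarrow> (real \<Rightarrow> real \<Rightarrow> real) \<Rightarrow> real \<Rightarrow> real \<Rightarrow> real" where
  "lipschitz_minorant \<alpha> f u v = (INF t\<in>{v..u}. f t v + \<alpha> * (u - t))"

context
  fixes \<alpha> :: real and f :: "real \<Rightarrow> real \<Rightarrow> real"
  assumes alpha: "0 \<le> \<alpha>"
    and nonneg: "\<And>u v. v \<le> u \<Longrightarrow> 0 \<le> f u v"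
begin

lemma lipschitz_minorant_le:
  assumes "v \<le> t" "t \<le> u"
  shows "lipschitz_minorant \<alpha> f u v \<le> f t v + \<alpha> * (u - t)"
  unfolding lipschitz_minorant_def
proof (rule cINF_lower)
  show "bdd_below ((\<lambda>t. f t v + \<alpha> * (u - t)) ` {v..u})"
    using nonneg alpha by (intro bdd_belowI2[of _ 0]) auto
qed (use assms in auto)

lemma le_lipschitz_minorant:
  assumes "v \<le> u" "\<And>t. v \<le> t \<Longrightarrow> t \<le> u \<Longrightarrow> b \<le> f t v + \<alpha> * (u - t)"
  shows "b \<le> lipschitz_minorant \<alpha> f u v"
  unfolding lipschitz_minorant_def using assms by (intro cINF_greatest) auto

text \<open>Superadditivity survives because a competitor \<open>t\<close> in the infimum at \<open>(u, v)\<close> splits at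
  \<open>w\<close>: if \<open>w \<le> t\<close>, then \<open>t\<close> competes at \<open>(u, w)\<close> and superadditivity of \<open>f\<close> bounds what
  remains by \<open>f w v\<close>; if \<open>t < w\<close>, then \<open>t\<close> competes at \<open>(w, v)\<close> and the linear cost on
  \<open>[w, u]\<close> is paid by the competitor \<open>w\<close> at \<open>(u, w)\<close>.\<close>

lemma lipschitz_minorant_branching_class:
  assumes diag: "\<And>u. f u u = 0"
    and super: "\<And>u v w. v \<le> w \<Longrightarrow> w \<le> u \<Longrightarrow> f u v \<ge> f u w + f w v"
  shows "lipschitz_minorant \<alpha> f \<in> branching_class \<alpha>"
proof -
  let ?g = "lipschitz_minorant \<alpha> f"
  have g0: "0 \<le> ?g u v" if "v \<le> u" for u v
    using that nonneg alpha by (intro le_lipschitz_minorant) auto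
  have gd: "?g u u = 0" for u
    using lipschitz_minorant_le[of u u u] diag g0[of u u] by auto
  have gs: "?g u w + ?g w v \<le> ?g u v" if vw: "v \<le> w" "w \<le> u" for u v w
  proof (rule le_lipschitz_minorant)
    fix t assume t: "v \<le> t" "t \<le> u"
    show "?g u w + ?g w v \<le> f t v + \<alpha> * (u - t)"
    proof (cases "w \<le> t")
      case True
      have "?g u w \<le> f t w + \<alpha> * (u - t)" "?g w v \<le> f w v + \<alpha> * (w - w)"
        using True t vw by (intro lipschitz_minorant_le; simp)+
      moreover have "f t w + f w v \<le> f t v" using True vw super by auto
      ultimately show ?thesis by simp
    next
      case False
      have "?g u w \<le> f w w + \<alpha> * (u - w)" "?g w v \<le> f t v + \<alpha> * (w - t)"
        using False t vw by (auto intro!: lipschitz_minorant_le)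
      then show ?thesis using diag by (simp add: algebra_simps)
    qed
  qed (use vw in auto)
  have up: "?g u v \<le> ?g u' v" if "v \<le> u" "u \<le> u'" for u u' v
    using gs[of v u u'] g0[of u u'] that by simp
  have lip: "?g u' v \<le> ?g u v + \<alpha> * (u' - u)" if "v \<le> u" "u \<le> u'" for u u' v
  proof -
    have "?g u' v - \<alpha> * (u' - u) \<le> ?g u v"
    proof (rule le_lipschitz_minorant)
      fix t assume "v \<le> t" "t \<le> u"
      then have "?g u' v \<le> f t v + \<alpha> * (u' - t)"
        using that by (intro lipschitz_minorant_le) auto
      then show "?g u' v - \<alpha> * (u' - u) \<le> f t v + \<alpha> * (u - t)" by (simp add: algebra_simps)
    qed (use that in auto)
    then show ?thesis by simp
  qed
  have "lipschitz_on \<alpha> {v..} (\<lambda>u. ?g u v)" for v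
  proof (rule lipschitz_onI)
    show "dist (?g a v) (?g b v) \<le> \<alpha> * dist a b" if "a \<in> {v..}" "b \<in> {v..}" for a b
      using that up[of v a b] up[of v b a] lip[of v a b] lip[of v b a]
      by (cases "a \<le> b") (auto simp: dist_real_def)
  qed (rule alpha)
  then show ?thesis using g0 gd gs by (auto simp: branching_class_def)
qed

end

lemma branching_class_antimono:
  assumes "f \<in> branching_class \<alpha>" "v \<le> w" "w \<le> u"
  shows "f u w \<le> f u v"
proof -
  have "f u w + f w v \<le> f u v" "0 \<le> f w v" using assms by (auto simp: branching_class_def)
  then show ?thesis by linarith
qed

lemma branching_class_lipschitz:
  assumes "f \<in> branching_class \<alpha>" "v \<le> u" "u \<le> u'"
  shows "f u' v \<le> f u v + \<alpha> * (u' - u)"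
proof -
  have "lipschitz_on \<alpha> {v..} (\<lambda>u. f u v)" using assms by (simp add: branching_class_def)
  then have "dist (f u v) (f u' v) \<le> \<alpha> * dist u u'"
    by (rule lipschitz_onD) (use assms in auto)
  then show ?thesis using assms by (auto simp: dist_real_def)
qed


section \<open>The branching function of a Euclidean set is regular\<close>

definition min_count :: "'a::metric_space set \<Rightarrow> real \<Rightarrow> real \<Rightarrow> nat" where
  "min_count X r R = the_enat (min_packing X r R)"

context
  fixes X :: "(real ^ 'n) set"
  assumes X: "X \<noteq> {}"
begin

lemma min_packing_finite:
  assumes "0 < r" "0 \<le> R"
  shows "min_packing X r R \<noteq> \<infinity>"
proof -
  obtain x where x: "x \<in> X" "min_packing X r R = packing_number r (X \<inter> cball x R)"
    using X by (rule min_packing_attained)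
  have "packing_number r (X \<inter> cball x R) \<le> enat (nat \<lfloor>(real CARD('n) * R / (2 * r) + 2) ^ CARD('n)\<rfloor>)"
  proof (rule packing_number_le)
    fix S assume "finite S" "S \<subseteq> X \<inter> cball x R" "separated r S"
    then have "real (card S) \<le> (real CARD('n) * R / (2 * r) + 2) ^ CARD('n)"
      using assms by (intro card_separated_le) auto
    then show "enat (card S) \<le> enat (nat \<lfloor>(real CARD('n) * R / (2 * r) + 2) ^ CARD('n)\<rfloor>)"
      by (simp add: le_nat_floor)
  qed
  then show ?thesis using x(2) by (metis enat_ord_simps(5) not_infinity_eq)
qed

lemma enat_min_count:
  assumes "0 < r" "0 \<le> R"
  shows "min_packing X r R = enat (min_count X r R)"
  using min_packing_finite[OF assms] by (auto simp: min_count_def)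

lemma min_count_pos:
  assumes "0 < r" "0 \<le> R"
  shows "1 \<le> min_count X r R"
  using min_packing_ge_1[OF assms(2), of X r] enat_min_count[OF assms] by (simp add: one_enat_def)

lemma min_count_mono:
  assumes "0 < s" "s \<le> r" "0 \<le> R" "R \<le> R'"
  shows "min_count X r R \<le> min_count X s R'"
  using min_packing_mono[of s r R R' X] enat_min_count[of r R] enat_min_count[of s R'] assms
  by simp

lemma min_count_superadditive:
  assumes "0 < r" "0 < s" "0 \<le> R" "0 \<le> R'" "4 * r + 2 * R' \<le> 4 * s"
  shows "min_count X s R * min_count X r R' \<le> min_count X r (R + R')"
  using min_packing_superadditive[of r R' s "min_count X s R" X R "min_count X r R'"] assms
  by (simp add: enat_min_count)

lemma min_count_refine:
  assumes "0 < r" "r \<le> s" "0 \<le> R"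
  shows "real (min_count X r R)
    \<le> real (min_count X s R) * ((2 * real CARD('n) + 2) * (s / r)) ^ CARD('n)"
proof -
  obtain x where x: "x \<in> X" "min_packing X s R = packing_number s (X \<inter> cball x R)"
    using X by (rule min_packing_attained)
  have "enat (min_count X r R) \<le> min_packing X r R"
    using enat_min_count[of r R] assms by simp
  then obtain S where "finite S" "S \<subseteq> X \<inter> cball x R" "separated r S" "card S = min_count X r R"
    unfolding enat_le_min_packing_iff using x(1) by blast
  then show ?thesis
    using packing_number_refine[of r s "X \<inter> cball x R" "min_count X s R" S] assms x(2)
      enat_min_count[of s R] by simp
qed

text \<open>Two points of a ball of radius \<open>r\<close> are at distance at most \<open>2 * r\<close>.\<close>

lemma min_count_eq_1:
  assumes "0 < r"
  shows "min_count X r r = 1"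
proof -
  obtain x where x: "x \<in> X" "min_packing X r r = packing_number r (X \<inter> cball x r)"
    using X by (rule min_packing_attained)
  have "packing_number r (X \<inter> cball x r) \<le> enat 1"
  proof (rule packing_number_le)
    fix S assume S: "finite S" "S \<subseteq> X \<inter> cball x r" "separated r S"
    have "a = b" if "a \<in> S" "b \<in> S" for a b
    proof (rule ccontr)
      assume "a \<noteq> b"
      then have "dist a b > 4 * r" using S that by (auto simp: separated_def)
      moreover have "dist x a \<le> r" "dist x b \<le> r" using S that by auto
      ultimately show False using dist_triangle[of a b x] assms by (simp add: dist_commute)
    qed
    then show "enat (card S) \<le> enat 1" using S by (simp add: card_le_Suc0_iff_eq)
  qed
  then have "enat (min_count X r r) \<le> enat 1" using x enat_min_count[of r r] assms by simp
  then show ?thesis using min_count_pos[of r r] assms by simp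
qed

definition log_count :: "real \<Rightarrow> real \<Rightarrow> real" where
  "log_count u v = log 2 (real (min_count X (2 powr (- u)) (2 powr (- v))))"

text \<open>The radius is reduced by the finest scale so that the radii add up in
  \<open>(2 powr (- v) - 2 powr (- w)) + (2 powr (- w) - 2 powr (- u))\<close>.\<close>

definition shrunk_log_count :: "real \<Rightarrow> real \<Rightarrow> real" where
  "shrunk_log_count u v
    = log 2 (real (min_count X (2 powr (- u)) (2 powr (- v) - 2 powr (- u))))"

lemma inf_branching_log_count: "inf_branching X u v = ereal (log_count u v)"
  using min_count_pos[of "2 powr (- u)" "2 powr (- v)"]
  by (simp add: inf_branching_min_packing log_count_def enat_min_count log2_enat_enat)

lemma shrunk_log_count_nonneg: "v \<le> u \<Longrightarrow> 0 \<le> shrunk_log_count u v"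
  using min_count_pos[of "2 powr (- u)" "2 powr (- v) - 2 powr (- u)"]
  by (simp add: shrunk_log_count_def)

lemma shrunk_log_count_le: "v \<le> u \<Longrightarrow> shrunk_log_count u v \<le> log_count u v"
  using min_count_pos[of "2 powr (- u)" "2 powr (- v) - 2 powr (- u)"]
    min_count_mono[of "2 powr (- u)" "2 powr (- u)" "2 powr (- v) - 2 powr (- u)" "2 powr (- v)"]
  by (simp add: shrunk_log_count_def log_count_def)

lemma log_count_le_shrunk: "v \<le> u \<Longrightarrow> log_count u v \<le> shrunk_log_count u (v - 1)"
  using min_count_pos[of "2 powr (- u)" "2 powr (- v)"]
    min_count_mono[of "2 powr (- u)" "2 powr (- u)" "2 powr (- v)" "2 powr (- (v - 1)) - 2 powr (- u)"]
    powr_mono[of "- u" "- v" "2::real"] powr_add[of "2::real" 1 "- v"]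
  by (simp add: shrunk_log_count_def log_count_def)

lemma shrunk_log_count_superadditive:
  assumes "v \<le> w" "w \<le> u"
  shows "shrunk_log_count u w + shrunk_log_count w v \<le> shrunk_log_count u v"
proof -
  let ?q = "\<lambda>t::real. 2 powr (- t)"
  have q: "?q u \<le> ?q w" "?q w \<le> ?q v" using assms by auto
  let ?m = "min_count X (?q w) (?q v - ?q w)" and ?n = "min_count X (?q u) (?q w - ?q u)"
  have "?m * ?n \<le> min_count X (?q u) ((?q v - ?q w) + (?q w - ?q u))"
    using q by (intro min_count_superadditive) auto
  then have "?m * ?n \<le> min_count X (?q u) (?q v - ?q u)" by simp
  then have "real ?m * real ?n \<le> real (min_count X (?q u) (?q v - ?q u))"
    by (metis of_nat_le_iff of_nat_mult)
  moreover have pos: "1 \<le> ?m" "1 \<le> ?n"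
    using q min_count_pos[of "?q w" "?q v - ?q w"] min_count_pos[of "?q u" "?q w - ?q u"]
    by auto
  then have "0 < real ?m" "0 < real ?n" by linarith+
  ultimately have "log 2 (real ?m * real ?n) \<le> log 2 (real (min_count X (?q u) (?q v - ?q u)))"
    "log 2 (real ?m * real ?n) = log 2 (real ?m) + log 2 (real ?n)"
    by (intro log_mono, simp_all add: log_mult)
  then show ?thesis unfolding shrunk_log_count_def by simp
qed

lemma shrunk_log_count_diag: "shrunk_log_count u u = 0"
  using shrunk_log_count_nonneg[of u u] shrunk_log_count_superadditive[of u u u] by simp

text \<open>The additive constant absorbs \<open>d * log 2 (2 * d + 2)\<close>, by \<open>d + 1 \<le> 2 ^ d\<close>.\<close>

lemma log_count_refine:
  fixes d :: real
  defines "d \<equiv> real CARD('n)"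
  assumes "t \<le> u"
  shows "log_count u v \<le> log_count t v + d * (u - t) + d * (d + 1)"
proof -
  let ?q = "\<lambda>t::real. 2 powr (- t)"
  let ?a = "real (min_count X (?q u) (?q v))" and ?b = "real (min_count X (?q t) (?q v))"
  have d: "0 < d" by (simp add: d_def)
  have pos: "0 < ?a" "0 < ?b"
    using min_count_pos[of "?q u" "?q v"] min_count_pos[of "?q t" "?q v"] by auto
  have "?q t / ?q u = 2 powr (u - t)" by (simp flip: powr_diff)
  then have le: "?a \<le> ?b * ((2 * d + 2) * 2 powr (u - t)) ^ CARD('n)"
    using min_count_refine[of "?q u" "?q t" "?q v"] assms by (simp add: d_def)
  have "log 2 (2 * d + 2) \<le> d + 1"
  proof -
    have "real (CARD('n) + 1) \<le> real (2 ^ CARD('n))"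
      by (metis Suc_eq_plus1 Suc_leI less_exp of_nat_mono)
    then have "2 * d + 2 \<le> 2 powr (d + 1)"
      by (simp add: d_def powr_add powr_realpow)
    then show ?thesis using d by (simp add: log_le_iff)
  qed
  then have "d * log 2 (2 * d + 2) \<le> d * (d + 1)" using d by simp
  moreover have "log 2 ?a \<le> log 2 (?b * ((2 * d + 2) * 2 powr (u - t)) ^ CARD('n))"
    using le pos by (intro log_mono) auto
  moreover have "log 2 (?b * ((2 * d + 2) * 2 powr (u - t)) ^ CARD('n))
      = log 2 ?b + d * (log 2 (2 * d + 2) + (u - t))"
    using pos d by (simp add: log_mult log_nat_power d_def del: of_nat_0_less_iff)
  ultimately show ?thesis by (simp add: log_count_def algebra_simps)
qed

text \<open>The minorant of the shrunk count is below the branching function by construction.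
  Conversely, a competitor \<open>t\<close> for the minorant at \<open>(u, v - 1)\<close> costs at least the
  logarithmic count at \<open>(u, v)\<close> up to a constant: refine from scale \<open>t\<close> if \<open>v \<le> t\<close>, and
  otherwise from scale \<open>v\<close>, where the count is \<open>1\<close>, so that the linear term alone suffices.\<close>

theorem inf_branching_sim_branching_class:
  fixes d z :: real
  defines "d \<equiv> real CARD('n)"
  assumes z: "1 \<le> z" "d * (d + 1) \<le> z"
  shows "\<exists>f \<in> branching_class d. branching_sim z (\<lambda>u v. ereal (f u v)) (inf_branching X)"
proof
  let ?f = "lipschitz_minorant d shrunk_log_count"
  have d: "0 \<le> d" by (simp add: d_def)
  note minorant = lipschitz_minorant_le[of d shrunk_log_count, OF d shrunk_log_count_nonneg]
    le_lipschitz_minorant[of d shrunk_log_count, OF d shrunk_log_count_nonneg]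
  show fclass: "?f \<in> branching_class d"
    using d shrunk_log_count_nonneg shrunk_log_count_diag shrunk_log_count_superadditive
    by (intro lipschitz_minorant_branching_class) auto
  have upper: "log_count u v - d * (d + 1) \<le> ?f u (v - 1)" if "v \<le> u" for u v
  proof (rule minorant(2))
    fix t assume t: "v - 1 \<le> t" "t \<le> u"
    show "log_count u v - d * (d + 1) \<le> shrunk_log_count t (v - 1) + d * (u - t)"
    proof (cases "v \<le> t")
      case True
      then show ?thesis
        using log_count_refine[of t u v] log_count_le_shrunk[of v t] t by (simp add: d_def)
    next
      case False
      have "log_count v v = 0" using min_count_eq_1 by (simp add: log_count_def)
      moreover have "d * (u - v) \<le> d * (u - t)" using False d by (intro mult_left_mono) auto
      ultimately show ?thesis
        using log_count_refine[of v u v, folded d_def] shrunk_log_count_nonneg[of "v - 1" t] t that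
        by linarith
    qed
  qed (use that in auto)
  show "branching_sim z (\<lambda>u v. ereal (?f u v)) (inf_branching X)"
    unfolding branching_sim_def inf_branching_log_count
  proof (intro allI impI conjI)
    fix u v :: real
    assume uv: "0 \<le> v \<and> v \<le> u"
    show "ereal (?f u (v + z)) - ereal z \<le> ereal (log_count u v)" if "v \<le> u - z"
    proof -
      have "?f u (v + z) \<le> ?f u v"
        using that z by (intro branching_class_antimono[OF fclass]) auto
      also have "\<dots> \<le> log_count u v"
        using minorant(1)[of v u u] shrunk_log_count_le[of v u] uv by simp
      finally show ?thesis using z by simp
    qed
    show "ereal (log_count u v) \<le> ereal (?f u (v - z)) + ereal z" if "z \<le> v"
    proof -
      have "?f u (v - 1) \<le> ?f u (v - z)"
        using z uv by (intro branching_class_antimono[OF fclass]) auto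
      then show ?thesis using upper[of v u] uv z by simp
    qed
  qed
qed

end

section \<open>Binary digit sets\<close>

text \<open>A pair \<open>(k, j)\<close> in \<open>F\<close> says that the \<open>k\<close>-th binary digit of the coordinate \<open>j\<close> is \<open>1\<close>.
  Only finite \<open>F\<close> are used: points with finitely many digits already have the right packing
  numbers, and different \<open>F\<close> give different points.\<close>

definition digit_point :: "(nat \<times> 'n) set \<Rightarrow> real ^ 'n::finite" where
  "digit_point F = (\<chi> j. \<Sum>k | (k, j) \<in> F. (1/2) ^ k)"

lemma finite_digits:
  assumes "finite F"
  shows "finite {k. (k, j) \<in> F}"
proof (rule finite_subset)
  show "{k. (k, j) \<in> F} \<subseteq> fst ` F" by (auto intro: rev_image_eqI)
qed (use assms in simp)

lemma sum_half_powers_le: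
  assumes "finite K" "K \<subseteq> {m<..}"
  shows "(\<Sum>k\<in>K. (1/2::real) ^ k) \<le> (1/2) ^ m"
proof -
  have geometric: "(\<Sum>k\<in>{m<..m + i}. (1/2::real) ^ k) = (1/2) ^ m - (1/2) ^ (m + i)" for i
  proof (induction i)
    case (Suc i)
    have "{m<..m + Suc i} = insert (m + Suc i) {m<..m + i}" by auto
    then show ?case using Suc by simp
  qed simp
  obtain N where N: "K \<subseteq> {..N}" using assms(1) finite_nat_iff_bounded_le by blast
  have "(\<Sum>k\<in>K. (1/2::real) ^ k) \<le> (\<Sum>k\<in>{m<..m + N}. (1/2) ^ k)"
    using assms N by (intro sum_mono2) (force simp: subset_iff)+
  then show ?thesis using geometric[of N] by (smt (verit) zero_le_power zero_le_divide_1_iff)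
qed

lemma digit_point_close:
  fixes F G :: "(nat \<times> 'n::finite) set"
  assumes "finite F" "finite G" "{p \<in> F. fst p \<le> m} = {p \<in> G. fst p \<le> m}"
  shows "\<bar>(digit_point F - digit_point G) $ j\<bar> \<le> (1/2) ^ m"
proof -
  define common where "common = (\<Sum>k | (k, j) \<in> F \<and> k \<le> m. (1/2::real) ^ k)"
  define tail where "tail = (\<lambda>H. \<Sum>k | (k, j) \<in> H \<and> m < k. (1/2::real) ^ k)"
  have split: "digit_point H $ j = (\<Sum>k | (k, j) \<in> H \<and> k \<le> m. (1/2) ^ k) + tail H"
    if "finite H" for H :: "(nat \<times> 'n) set"
  proof -
    have "digit_point H $ j = (\<Sum>k | (k, j) \<in> H. (1/2) ^ k)" by (simp add: digit_point_def)
    also have "{k. (k, j) \<in> H} = {k. (k, j) \<in> H \<and> k \<le> m} \<union> {k. (k, j) \<in> H \<and> m < k}"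
      by auto
    also have "(\<Sum>k\<in>\<dots>. (1/2) ^ k) = (\<Sum>k | (k, j) \<in> H \<and> k \<le> m. (1/2) ^ k) + tail H"
      unfolding tail_def using finite_digits[OF that, of j] by (intro sum.union_disjoint) auto
    finally show ?thesis .
  qed
  have "{k. (k, j) \<in> {p \<in> F. fst p \<le> m}} = {k. (k, j) \<in> {p \<in> G. fst p \<le> m}}"
    unfolding assms(3) ..
  then have "{k. (k, j) \<in> F \<and> k \<le> m} = {k. (k, j) \<in> G \<and> k \<le> m}" by simp
  then have "digit_point F $ j = common + tail F" "digit_point G $ j = common + tail G"
    using split[OF assms(1)] split[OF assms(2)] by (simp_all add: common_def)
  moreover have tail: "0 \<le> tail H" "tail H \<le> (1/2) ^ m" if "finite H" for H
    unfolding tail_def using finite_digits[OF that, of j]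
    by (auto intro!: sum_nonneg sum_half_powers_le)
  ultimately show ?thesis using tail[OF assms(1)] tail[OF assms(2)] by (simp add: abs_le_iff)
qed

lemma digit_point_bounds:
  assumes "finite F" "F \<subseteq> {w<..} \<times> UNIV"
  shows "0 \<le> digit_point F $ j" "digit_point F $ j \<le> (1/2) ^ w"
  using assms finite_digits[OF assms(1), of j]
  by (auto simp: digit_point_def intro!: sum_nonneg sum_half_powers_le)

text \<open>In units of \<open>(1/2) ^ m\<close> the coordinates are natural numbers, and the digits can be
  read off from them by \<open>set_encode\<close>; different numbers differ by at least one unit.\<close>

lemma digit_point_separated:
  fixes F G :: "(nat \<times> 'n::finite) set"
  assumes "F \<subseteq> {..m} \<times> UNIV" "G \<subseteq> {..m} \<times> UNIV" "F \<noteq> G"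
  shows "(1/2) ^ m \<le> dist (digit_point F) (digit_point G)"
proof -
  define code :: "(nat \<times> 'n) set \<Rightarrow> 'n \<Rightarrow> nat"
    where "code = (\<lambda>H j. set_encode ((\<lambda>k. m - k) ` {k. (k, j) \<in> H}))"
  have code: "digit_point H $ j = real (code H j) * (1/2) ^ m" if "H \<subseteq> {..m} \<times> UNIV" for H j
  proof -
    have "inj_on (\<lambda>k. m - k) {..m}" by (rule inj_onI) auto
    then have inj: "inj_on (\<lambda>k. m - k) {k. (k, j) \<in> H}"
      by (rule inj_on_subset) (use that in auto)
    have "real (code H j) * (1/2) ^ m = (\<Sum>k | (k, j) \<in> H. 2 ^ (m - k) * (1/2) ^ m)"
      by (simp add: code_def set_encode_def sum.reindex[OF inj] sum_distrib_right)
    also have "\<dots> = (\<Sum>k | (k, j) \<in> H. (1/2) ^ k)"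
    proof (rule sum.cong[OF refl])
      fix k assume "k \<in> {k. (k, j) \<in> H}"
      then have "k \<le> m" using that by auto
      then show "2 ^ (m - k) * (1/2) ^ m = (1/2 :: real) ^ k"
        by (simp add: power_diff power_one_over field_simps)
    qed
    finally show ?thesis by (simp add: digit_point_def)
  qed
  obtain j where j: "{k. (k, j) \<in> F} \<noteq> {k. (k, j) \<in> G}" using assms(3) by auto
  have sub: "{k. (k, j) \<in> F} \<subseteq> {..m}" "{k. (k, j) \<in> G} \<subseteq> {..m}" using assms by auto
  have "inj_on (\<lambda>k. m - k) {..m}" by (rule inj_onI) auto
  then have "(\<lambda>k. m - k) ` {k. (k, j) \<in> F} \<noteq> (\<lambda>k. m - k) ` {k. (k, j) \<in> G}"
    using j by (simp add: inj_on_image_eq_iff[OF _ sub])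
  moreover have "finite {k. (k, j) \<in> F}" "finite {k. (k, j) \<in> G}"
    using sub finite_subset by blast+
  ultimately have "code F j \<noteq> code G j" unfolding code_def by (subst set_encode_eq) auto
  then have "1 \<le> \<bar>real (code F j) - real (code G j)\<bar>" by linarith
  then have "(1/2) ^ m \<le> \<bar>real (code F j) - real (code G j)\<bar> * (1/2) ^ m" by simp
  also have "\<dots> = \<bar>(digit_point F - digit_point G) $ j\<bar>"
    using code assms by (simp add: abs_mult flip: left_diff_distrib)
  also have "\<dots> \<le> dist (digit_point F) (digit_point G)"
    unfolding dist_norm by (rule component_le_norm_cart)
  finally show ?thesis .
qed

text \<open>The coordinates \<open>D k\<close> are the ones whose \<open>k\<close>-th digit is free.\<close>

definition digit_set :: "(nat \<Rightarrow> 'n set) \<Rightarrow> nat \<Rightarrow> (real ^ 'n::finite) set" where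
  "digit_set D w = digit_point ` {F. finite F \<and> F \<subseteq> Sigma {w<..} D}"

lemma zero_in_digit_set: "0 \<in> digit_set D w"
proof -
  have "digit_point {} = 0" by (simp add: digit_point_def vec_eq_iff)
  then show ?thesis unfolding digit_set_def by (metis (mono_tags, lifting) empty_subsetI finite.emptyI image_eqI mem_Collect_eq)
qed

lemma digit_set_bounds:
  assumes "x \<in> digit_set D w"
  shows "0 \<le> x $ j" "x $ j \<le> (1/2) ^ w"
proof -
  obtain F where "x = digit_point F" "finite F" "F \<subseteq> {w<..} \<times> UNIV"
    using assms unfolding digit_set_def by fast
  then show "0 \<le> x $ j" "x $ j \<le> (1/2) ^ w" using digit_point_bounds by auto
qed

text \<open>Keep the digits of \<open>x\<close> up to level \<open>k\<close>, choose the free digits on the levels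
  \<open>k + 1, \<dots>, m\<close> arbitrarily and drop all later ones.\<close>

lemma digit_set_many_points:
  fixes D :: "nat \<Rightarrow> 'n::finite set"
  assumes x: "x \<in> digit_set D w" and "w \<le> k"
  obtains S where "S \<subseteq> digit_set D w" "finite S" "card S = 2 ^ card (Sigma {k<..m} D)"
    "\<And>y j. y \<in> S \<Longrightarrow> \<bar>(y - x) $ j\<bar> \<le> (1/2) ^ k"
    "\<And>y y'. y \<in> S \<Longrightarrow> y' \<in> S \<Longrightarrow> y \<noteq> y' \<Longrightarrow> (1/2) ^ (max k m) \<le> dist y y'"
proof -
  obtain F where F: "x = digit_point F" "finite F" "F \<subseteq> Sigma {w<..} D"
    using x by (auto simp: digit_set_def)
  define prefix where "prefix = {p \<in> F. fst p \<le> k}"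
  define point where "point = (\<lambda>G. digit_point (prefix \<union> G))"
  let ?G = "Pow (Sigma {k<..m} D)"
  have fin: "finite (Sigma {k<..m} D)" by auto
  have finG: "finite G" if "G \<in> ?G" for G using that fin finite_subset by blast
  have sep: "(1/2) ^ (max k m) \<le> dist (point G) (point G')" if "G \<in> ?G" "G' \<in> ?G" "G \<noteq> G'" for G G'
    unfolding point_def
  proof (rule digit_point_separated)
    have "prefix \<inter> Sigma {k<..m} D = {}" by (auto simp: prefix_def)
    then show "prefix \<union> G \<noteq> prefix \<union> G'" using that by blast
  qed (use that in \<open>force simp: prefix_def\<close>)+
  then have "inj_on point ?G"
    by (intro inj_onI) (metis dist_self not_one_le_zero power_eq_0_iff zero_less_divide_1_iff zero_less_numeral zero_less_power not_less)
  then have "card (point ` ?G) = 2 ^ card (Sigma {k<..m} D)"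
    using fin by (simp add: card_image card_Pow)
  moreover have "point ` ?G \<subseteq> digit_set D w"
  proof
    fix y assume "y \<in> point ` ?G"
    then obtain G where G: "G \<in> ?G" "y = point G" by auto
    then have "finite (prefix \<union> G)" "prefix \<union> G \<subseteq> Sigma {w<..} D"
      using F finG assms(2) by (auto simp: prefix_def)
    then show "y \<in> digit_set D w" using G by (auto simp: digit_set_def point_def)
  qed
  moreover have "\<bar>(y - x) $ j\<bar> \<le> (1/2) ^ k" if "y \<in> point ` ?G" for y j
  proof -
    obtain G where G: "G \<in> ?G" "y = point G" using \<open>y \<in> point ` ?G\<close> by auto
    have "{p \<in> prefix \<union> G. fst p \<le> k} = {p \<in> F. fst p \<le> k}"
      using G by (auto simp: prefix_def)
    then show ?thesis unfolding G(2) F(1) point_def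
      using F finG[OF G(1)] by (intro digit_point_close) (auto simp: prefix_def)
  qed
  ultimately show ?thesis using that[of "point ` ?G"] sep fin by blast
qed

text \<open>Points with the same digits up to level \<open>m\<close> are too close to both belong to \<open>S\<close>, so
  \<open>S\<close> injects into the possible patterns of these digits.\<close>

lemma digit_set_few_points:
  fixes D :: "nat \<Rightarrow> 'n::finite set"
  assumes "S \<subseteq> digit_set D w"
    and far: "\<And>x y. x \<in> S \<Longrightarrow> y \<in> S \<Longrightarrow> x \<noteq> y \<Longrightarrow> real CARD('n) * (1/2) ^ m < dist x y"
  shows "card S \<le> 2 ^ card (Sigma {w<..m} D)"
proof -
  define digits where "digits = inv_into {F. finite F \<and> F \<subseteq> Sigma {w<..} D} digit_point"
  have digits: "digit_point (digits x) = x" "finite (digits x)" "digits x \<subseteq> Sigma {w<..} D"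
    if "x \<in> S" for x
  proof -
    have x: "x \<in> digit_point ` {F. finite F \<and> F \<subseteq> Sigma {w<..} D}"
      using that assms(1) by (auto simp: digit_set_def)
    show "digit_point (digits x) = x" using f_inv_into_f[OF x] by (simp add: digits_def)
    show "finite (digits x)" "digits x \<subseteq> Sigma {w<..} D"
      using inv_into_into[OF x] by (simp_all add: digits_def)
  qed
  define cylinder where "cylinder = (\<lambda>x. {p \<in> digits x. fst p \<le> m})"
  have "inj_on cylinder S"
  proof (rule inj_onI, rule ccontr)
    fix x y assume xy: "x \<in> S" "y \<in> S" "cylinder x = cylinder y" "x \<noteq> y"
    have "\<bar>(x - y) $ j\<bar> \<le> (1/2) ^ m" for j
      using digit_point_close[of "digits x" "digits y" m j] digits xy by (simp add: cylinder_def)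
    then have "dist x y \<le> real CARD('n) * (1/2) ^ m"
      unfolding dist_norm by (rule norm_le_card_mult)
    then show False using far xy by fastforce
  qed
  moreover have "cylinder ` S \<subseteq> Pow (Sigma {w<..m} D)"
    using digits by (force simp: cylinder_def)
  ultimately have "card S \<le> card (Pow (Sigma {w<..m} D))" by (intro card_inj_on_le) auto
  then show ?thesis by (simp add: card_Pow)
qed

section \<open>A Euclidean set with prescribed branching\<close>

context
  fixes f :: "real \<Rightarrow> real \<Rightarrow> real"
  assumes f: "f \<in> branching_class (real CARD('n::finite))"
begin

lemma
  shows f_nonneg: "v \<le> u \<Longrightarrow> 0 \<le> f u v"
    and f_super: "v \<le> w \<Longrightarrow> w \<le> u \<Longrightarrow> f u w + f w v \<le> f u v"
  using f unfolding branching_class_def by blast+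

definition digit_count :: "nat \<Rightarrow> nat \<Rightarrow> nat" where
  "digit_count w k = nat \<lfloor>f (real k) (real w)\<rfloor>"

lemma digit_count_bounds:
  assumes "w \<le> k"
  shows "f (real k) (real w) - 1 < real (digit_count w k)"
    and "real (digit_count w k) \<le> f (real k) (real w)"
  using f_nonneg[of "real w" "real k"] assms by (auto simp: digit_count_def)

text \<open>One level has room for exactly \<open>d\<close> digits. The increments of the integer parts respect
  this because the Lipschitz constant \<open>d\<close> is an integer.\<close>

lemma digit_count_Suc:
  assumes "w \<le> k"
  shows "digit_count w k \<le> digit_count w (Suc k)"
    and "digit_count w (Suc k) \<le> digit_count w k + CARD('n)"
proof -
  let ?a = "f (real k) (real w)" and ?b = "f (real (Suc k)) (real w)"
  have ab: "?a \<le> ?b"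
    using f_super[of "real w" "real k" "real (Suc k)"] f_nonneg[of "real k" "real (Suc k)"] assms
    by simp
  then show "digit_count w k \<le> digit_count w (Suc k)"
    unfolding digit_count_def by (intro nat_mono floor_mono)
  have "?b \<le> ?a + real CARD('n)"
    using branching_class_lipschitz[OF f, of "real w" "real k" "real (Suc k)"] assms by simp
  then have "\<lfloor>?b\<rfloor> \<le> \<lfloor>?a\<rfloor> + int CARD('n)" by linarith
  then show "digit_count w (Suc k) \<le> digit_count w k + CARD('n)"
    using f_nonneg[of "real w" "real k"] assms unfolding digit_count_def by simp
qed

text \<open>The cardinalities telescope, so that the piece of index \<open>w\<close> has as many cylinders at
  level \<open>k\<close> as there are subsets of a set with about \<open>f k w\<close> elements.\<close>

definition free_coords :: "nat \<Rightarrow> nat \<Rightarrow> 'n set" where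
  "free_coords w k = (SOME A. card A = digit_count w k - digit_count w (k - 1))"

lemma card_free_coords:
  assumes "w < k"
  shows "card (free_coords w k) = digit_count w k - digit_count w (k - 1)"
proof -
  have "digit_count w k - digit_count w (k - 1) \<le> CARD('n)"
    using digit_count_Suc(2)[of w "k - 1"] assms by (cases k) simp_all
  then have "\<exists>A::'n set. card A = digit_count w k - digit_count w (k - 1)"
    by (meson obtain_subset_with_card_n)
  then show ?thesis unfolding free_coords_def by (rule someI_ex)
qed

lemma card_free_positions:
  assumes "w \<le> k" "k \<le> m"
  shows "digit_count w k + card (Sigma {k<..m} (free_coords w)) = digit_count w m"
  using assms(2)
proof (induction m rule: dec_induct)
  case (step m)
  have "{k<..Suc m} = insert (Suc m) {k<..m}" using step by auto
  then show ?case
    using step assms(1) card_free_coords[of w "Suc m"] digit_count_Suc(1)[of w m] by simp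
qed simp

text \<open>The digit set lies in a cube of side \<open>(1/2) ^ w\<close>. The diagonal shift by
  \<open>2 * (1/2) ^ w\<close> moves the coordinates into \<open>[2 * (1/2) ^ w, 3 * (1/2) ^ w]\<close>; these
  intervals are pairwise disjoint and their gaps are comparable to their lengths.\<close>

definition piece :: "nat \<Rightarrow> (real ^ 'n) set" where
  "piece w = (\<lambda>x. vec (2 * (1/2) ^ w) + x) ` digit_set (free_coords w) w"

definition branching_set :: "(real ^ 'n) set" where
  "branching_set = (\<Union>w. piece w)"

lemma piece_nonempty: "vec (2 * (1/2) ^ w) \<in> piece w"
  using zero_in_digit_set unfolding piece_def by (force simp: image_iff)

lemma piece_bounds:
  assumes "x \<in> piece w"
  shows "2 * (1/2) ^ w \<le> x $ j" "x $ j \<le> 3 * (1/2) ^ w"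
  using assms digit_set_bounds[of _ "free_coords w" w j] by (auto simp: piece_def)

lemma piece_many_points:
  assumes x: "x \<in> piece w" and "w \<le> k" "k \<le> m"
  obtains S where "S \<subseteq> piece w" "finite S" "card S = 2 ^ (digit_count w m - digit_count w k)"
    "\<And>y j. y \<in> S \<Longrightarrow> \<bar>(y - x) $ j\<bar> \<le> (1/2) ^ k"
    "\<And>y y'. y \<in> S \<Longrightarrow> y' \<in> S \<Longrightarrow> y \<noteq> y' \<Longrightarrow> (1/2) ^ m \<le> dist y y'"
proof -
  let ?shift = "\<lambda>x::real^'n. vec (2 * (1/2) ^ w) + x"
  obtain x' where x': "x = ?shift x'" "x' \<in> digit_set (free_coords w) w"
    using x by (auto simp: piece_def)
  obtain S where S: "S \<subseteq> digit_set (free_coords w) w" "finite S"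
    "card S = 2 ^ card (Sigma {k<..m} (free_coords w))"
    "\<And>y j. y \<in> S \<Longrightarrow> \<bar>(y - x') $ j\<bar> \<le> (1/2) ^ k"
    "\<And>y y'. y \<in> S \<Longrightarrow> y' \<in> S \<Longrightarrow> y \<noteq> y' \<Longrightarrow> (1/2) ^ (max k m) \<le> dist y y'"
    using digit_set_many_points[OF x'(2) assms(2), of m] by blast
  have "card (?shift ` S) = card S" by (intro card_image) (simp add: inj_on_def)
  moreover have "card (Sigma {k<..m} (free_coords w)) = digit_count w m - digit_count w k"
    using card_free_positions[of w k m] assms by simp
  moreover have "\<bar>(y - x) $ j\<bar> \<le> (1/2) ^ k" if "y \<in> ?shift ` S" for y j
    using that S(4)[of _ j] x'(1) by force
  moreover have "(1/2) ^ m \<le> dist y y'" if "y \<in> ?shift ` S" "y' \<in> ?shift ` S" "y \<noteq> y'" for y y'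
    using that S(5) assms(3) by (force simp: max_def split: if_splits)
  ultimately show ?thesis
    using that[of "?shift ` S"] S(1,2,3) by (auto simp: piece_def)
qed

text \<open>If \<open>x\<close> lies in a piece \<open>w\<close> with \<open>w < k\<close>, the points are taken from that piece, and
  superadditivity of \<open>f\<close> compares its count \<open>f m w - f k w\<close> with \<open>f m k\<close>. Otherwise they
  fill the piece \<open>k\<close>, which is near \<open>x\<close> because both are near the origin.\<close>

lemma branching_set_many_points:
  assumes x: "x \<in> branching_set" and "k \<le> m"
  obtains S where "S \<subseteq> branching_set" "finite S" "f m k - 1 \<le> log 2 (real (card S))" "0 < card S"
    "\<And>y. y \<in> S \<Longrightarrow> dist x y \<le> 3 * real CARD('n) * (1/2) ^ k"
    "\<And>y y'. y \<in> S \<Longrightarrow> y' \<in> S \<Longrightarrow> y \<noteq> y' \<Longrightarrow> (1/2) ^ m \<le> dist y y'"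
proof -
  obtain w where w: "x \<in> piece w" using x by (auto simp: branching_set_def)
  \<comment> \<open>With \<open>w' = k\<close> there are no digits to be kept, so any \<open>x'\<close> in the piece serves.\<close>
  define w' where "w' = min w k"
  obtain x' where x': "x' \<in> piece w'" "w < k \<Longrightarrow> x' = x"
    using w piece_nonempty[of w'] by (cases "w < k") (auto simp: w'_def)
  obtain S where S: "S \<subseteq> piece w'" "finite S" "card S = 2 ^ (digit_count w' m - digit_count w' k)"
    "\<And>y j. y \<in> S \<Longrightarrow> \<bar>(y - x') $ j\<bar> \<le> (1/2) ^ k"
    "\<And>y y'. y \<in> S \<Longrightarrow> y' \<in> S \<Longrightarrow> y \<noteq> y' \<Longrightarrow> (1/2) ^ m \<le> dist y y'"
    using piece_many_points[OF x'(1), of k m] assms(2) by (auto simp: w'_def)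
  have "f m k + f k w' \<le> f m w'"
    using assms(2) by (intro f_super) (auto simp: w'_def)
  then have "f m k - 1 \<le> real (digit_count w' m) - real (digit_count w' k)"
    using digit_count_bounds(1)[of w' m] digit_count_bounds(2)[of w' k] assms(2)
    by (simp add: w'_def min.coboundedI2)
  also have "\<dots> \<le> log 2 (real (card S))"
    by (simp add: S(3) log_nat_power)
  finally have "f m k - 1 \<le> log 2 (real (card S))" .
  moreover have "dist x y \<le> 3 * real CARD('n) * (1/2) ^ k" if y: "y \<in> S" for y
  proof -
    have "\<bar>(y - x) $ j\<bar> \<le> 3 * (1/2) ^ k" for j
    proof (cases "w < k")
      case True
      have "(0::real) \<le> (1/2) ^ k" by simp
      then show ?thesis using S(4)[OF y, of j] unfolding x'(2)[OF True] by linarith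
    next
      case False
      then have "y \<in> piece k" using S y by (auto simp: w'_def min_def split: if_splits)
      then have "2 * (1/2) ^ k \<le> y $ j" "y $ j \<le> 3 * (1/2) ^ k" by (rule piece_bounds)+
      moreover have "2 * (1/2) ^ w \<le> x $ j" "x $ j \<le> 3 * (1/2) ^ w" using w by (rule piece_bounds)+
      moreover have "(1/2::real) ^ w \<le> (1/2) ^ k" using False by (intro power_decreasing) auto
      moreover have "(0::real) \<le> (1/2) ^ w" by simp
      ultimately show ?thesis unfolding vector_minus_component by linarith
    qed
    then have "norm (y - x) \<le> real CARD('n) * (3 * (1/2) ^ k)" by (rule norm_le_card_mult)
    then show ?thesis by (simp add: dist_norm norm_minus_commute mult_ac)
  qed
  ultimately show ?thesis using that[of S] S by (auto simp: branching_set_def)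
qed

lemma piece_isolated:
  assumes "x \<in> piece w" "y \<in> branching_set" "dist x y \<le> (1/2) ^ (w + 2)"
  shows "y \<in> piece w"
proof -
  obtain w' where y: "y \<in> piece w'" using assms(2) by (auto simp: branching_set_def)
  fix j :: 'n
  have pos: "(0::real) < (1/2) ^ w" by simp
  have "\<bar>(x - y) $ j\<bar> \<le> (1/2) ^ (w + 2)"
    using component_le_norm_cart[of "x - y" j] assms(3) by (simp add: dist_norm)
  then have close: "\<bar>x $ j - y $ j\<bar> \<le> (1/4) * (1/2) ^ w" by simp
  note bounds = piece_bounds[OF assms(1), of j] piece_bounds[OF y, of j]
  have "w' = w"
  proof (rule ccontr)
    assume "w' \<noteq> w"
    then consider "Suc w' \<le> w" | "Suc w \<le> w'" by linarith
    then show False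
    proof cases
      case 1
      then have "(1/2::real) ^ w \<le> (1/2) ^ Suc w'" by (intro power_decreasing) auto
      then have "4 * (1/2::real) ^ w \<le> 2 * (1/2) ^ w'" by simp
      then show False using bounds close pos by linarith
    next
      case 2
      then have "(1/2::real) ^ w' \<le> (1/2) ^ Suc w" by (intro power_decreasing) auto
      then have "2 * (1/2::real) ^ w' \<le> (1/2) ^ w" by simp
      then show False using bounds close pos by linarith
    qed
  qed
  then show ?thesis using y by simp
qed

lemma half_power_powr: "(1/2::real) ^ k = 2 powr (- real k)"
  by (simp add: powr_minus powr_realpow power_one_over inverse_eq_divide)

text \<open>The scales are matched with integer levels. In dimension \<open>d\<close> the Euclidean norm
  exceeds the maximum norm by a factor of at most \<open>d \<le> 2 ^ d\<close>, which costs \<open>d\<close> levels;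
  rounding costs a few more. A difference of \<open>c\<close> levels in the first argument of \<open>f\<close> costs
  \<open>c * d\<close>, which is where the quadratic term in the bound for \<open>z\<close> comes from.\<close>

theorem branching_set_sim:
  fixes d z :: real
  defines "d \<equiv> real CARD('n)"
  assumes z: "d * d + 4 * d + 6 \<le> z"
  shows "branching_sim z (\<lambda>u v. ereal (f u v)) (inf_branching branching_set)"
  unfolding branching_sim_def
proof (intro allI impI conjI)
  fix u v :: real
  assume "0 \<le> v \<and> v \<le> u"
  then have uv: "0 \<le> v" "v \<le> u" by auto
  have d: "1 \<le> d" by (simp add: d_def Suc_leI)
  have dd: "0 \<le> d * d" by simp
  have d_le: "d \<le> 2 ^ CARD('n)"
    unfolding d_def by (metis less_exp less_imp_le of_nat_le_iff of_nat_numeral of_nat_power)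
  show "ereal (f u (v + z)) - ereal z \<le> inf_branching branching_set u v" if gap: "v \<le> u - z"
  proof -
    \<comment> \<open>\<open>k\<close> is so large that \<open>3 * d * (1/2) ^ k\<close> fits into the ball, and \<open>m\<close> is the largest level at which
        digits are separated at scale \<open>u\<close>.\<close>
    define k where "k = nat \<lceil>v\<rceil> + CARD('n) + 2"
    define m where "m = nat (\<lceil>u\<rceil> - 3)"
    have k: "v + d + 2 \<le> k" "k \<le> v + d + 3"
      using uv unfolding k_def d_def by (simp, linarith)+
    have m: "u - 3 \<le> m" "m < u - 2"
      using uv gap z d dd unfolding m_def by linarith+
    have "k \<le> m" using k m gap z d dd by linarith
    have radius: "3 * d * (1/2) ^ k \<le> 2 powr (- v)"
    proof -
      have "d * (1/2) ^ CARD('n) \<le> 1" using d_le by (simp add: power_one_over field_simps)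
      have "(1/2::real) ^ nat \<lceil>v\<rceil> \<le> 2 powr (- v)"
        unfolding half_power_powr using uv by simp
      moreover have "3 * d * (1/2) ^ k = (1/2) ^ nat \<lceil>v\<rceil> * (3/4 * (d * (1/2) ^ CARD('n)))"
        by (simp add: k_def power_add)
      moreover have "\<dots> \<le> (1/2) ^ nat \<lceil>v\<rceil> * 1"
        using \<open>d * (1/2) ^ CARD('n) \<le> 1\<close> by (intro mult_left_mono) auto
      ultimately show ?thesis by linarith
    qed
    have scale: "4 * 2 powr (- u) < (1/2) ^ m"
    proof -
      have "4 * 2 powr (- u) = 2 powr (2 - u)" by (simp add: powr_diff powr_minus field_simps)
      also have "\<dots> < 2 powr (- real m)" using m by simp
      finally show ?thesis by (simp add: half_power_powr)
    qed
    \<comment> \<open>A lower bound that is independent of the point, as the infimum requires.\<close>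
    define n where "n = nat \<lceil>2 powr (f m k - 1)\<rceil>"
    have n_le: "n \<le> c" if "f m k - 1 \<le> log 2 (real c)" "0 < c" for c
    proof -
      have "2 powr (f m k - 1) \<le> real c" using that by (simp add: le_log_iff)
      then show ?thesis by (simp add: n_def nat_le_iff ceiling_le_iff)
    qed
    have "enat n \<le> min_packing branching_set (2 powr (- u)) (2 powr (- v))"
      unfolding min_packing_def
    proof (rule INF_greatest)
      fix x assume "x \<in> branching_set"
      then obtain S where S: "S \<subseteq> branching_set" "finite S" "f m k - 1 \<le> log 2 (real (card S))"
        "0 < card S" "\<And>y. y \<in> S \<Longrightarrow> dist x y \<le> 3 * d * (1/2) ^ k"
        "\<And>y y'. y \<in> S \<Longrightarrow> y' \<in> S \<Longrightarrow> y \<noteq> y' \<Longrightarrow> (1/2) ^ m \<le> dist y y'"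
        using branching_set_many_points[OF _ \<open>k \<le> m\<close>] unfolding d_def by metis
      have "enat n \<le> enat (card S)" using S n_le by simp
      also have "\<dots> \<le> packing_number (2 powr (- u)) (branching_set \<inter> cball x (2 powr (- v)))"
      proof (rule card_le_packing_number)
        show "S \<subseteq> branching_set \<inter> cball x (2 powr (- v))" using S radius by force
        show "separated (2 powr (- u)) S" using S scale by (force simp: separated_def)
      qed (rule S)
      finally show "enat n \<le> packing_number (2 powr (- u)) (branching_set \<inter> cball x (2 powr (- v)))" .
    qed
    then have "log2_enat (enat n) \<le> inf_branching branching_set u v"
      unfolding inf_branching_min_packing by (rule log2_enat_mono)
    moreover have "f u (v + z) - z \<le> log 2 (real n)"
    proof -
      have "f u (v + z) \<le> f u k"
        using branching_class_antimono[OF f, of k "v + z" u] k z d dd gap by simp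
      also have "\<dots> \<le> f m k + d * (u - m)"
        using branching_class_lipschitz[OF f, of k m u] \<open>k \<le> m\<close> m by (simp add: d_def)
      also have "\<dots> \<le> f m k + d * 3" using m d by (intro add_left_mono mult_left_mono) auto
      finally have "f u (v + z) - z \<le> f m k - 1" using z d dd by linarith
      also have "\<dots> = log 2 (2 powr (f m k - 1))" by simp
      also have "\<dots> \<le> log 2 (real n)" unfolding n_def by (intro log_mono) auto
      finally show ?thesis .
    qed
    moreover have "0 < n" by (simp add: n_def)
    ultimately show ?thesis by (auto simp: log2_enat_enat intro: order_trans[rotated])
  qed
  show "inf_branching branching_set u v \<le> ereal (f u (v - z)) + ereal z" if vz: "z \<le> v"
  proof -
    \<comment> \<open>The two extra levels make the ball smaller than the gaps around the piece \<open>w\<close>; at level \<open>m\<close> the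
        cylinders have diameter at most the separation at scale \<open>u\<close>.\<close>
    define w where "w = nat \<lfloor>v\<rfloor> - 2"
    define m where "m = nat \<lceil>u\<rceil> + CARD('n)"
    have w: "v - 3 \<le> w" "w + 2 \<le> v"
      using vz z d dd unfolding w_def by linarith+
    have m: "u + d \<le> m" "m \<le> u + d + 1" using uv unfolding m_def d_def by (simp, linarith)+
    have "w \<le> m" using w m uv d by linarith
    have scale: "d * (1/2) ^ m \<le> 4 * 2 powr (- u)"
    proof -
      have "d * (1/2) ^ m = (1/2) ^ nat \<lceil>u\<rceil> * (d * (1/2) ^ CARD('n))"
        by (simp add: m_def power_add)
      also have "\<dots> \<le> (1/2) ^ nat \<lceil>u\<rceil> * 1"
        using d_le by (intro mult_left_mono) (auto simp: power_one_over field_simps)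
      also have "\<dots> \<le> 2 powr (- u)"
        unfolding half_power_powr using uv by simp
      also have "\<dots> \<le> 4 * 2 powr (- u)" by simp
      finally show ?thesis .
    qed
    let ?x = "vec (2 * (1/2) ^ w) :: real ^ 'n"
    have x: "?x \<in> piece w" "?x \<in> branching_set"
      using piece_nonempty by (auto simp: branching_set_def)
    have "2 powr (- v) \<le> (1/2) ^ (w + 2)" unfolding half_power_powr using w by simp
    then have ball: "branching_set \<inter> cball ?x (2 powr (- v)) \<subseteq> piece w"
      using piece_isolated[OF x(1)] by auto
    have "min_packing branching_set (2 powr (- u)) (2 powr (- v))
        \<le> packing_number (2 powr (- u)) (branching_set \<inter> cball ?x (2 powr (- v)))"
      unfolding min_packing_def using x by (intro INF_lower)
    also have "\<dots> \<le> enat (2 ^ digit_count w m)"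
    proof (rule packing_number_le)
      fix S assume S: "S \<subseteq> branching_set \<inter> cball ?x (2 powr (- v))" "separated (2 powr (- u)) S"
      let ?T = "(\<lambda>y. y - ?x) ` S"
      have "card S = card ?T" by (intro card_image[symmetric]) (simp add: inj_on_def)
      also have "\<dots> \<le> 2 ^ card (Sigma {w<..m} (free_coords w))"
      proof (rule digit_set_few_points)
        show "?T \<subseteq> digit_set (free_coords w) w" using S ball by (force simp: piece_def)
        fix a b assume "a \<in> ?T" "b \<in> ?T" "a \<noteq> b"
        then have "4 * 2 powr (- u) < dist a b" using S(2) by (auto simp: separated_def dist_norm)
        then show "real CARD('n) * (1/2) ^ m < dist a b" using scale by (simp add: d_def)
      qed
      also have "\<dots> \<le> 2 ^ digit_count w m"
        using card_free_positions[of w w m] \<open>w \<le> m\<close> by (intro power_increasing) auto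
      finally show "enat (card S) \<le> enat (2 ^ digit_count w m)" by simp
    qed
    finally have "inf_branching branching_set u v \<le> log2_enat (enat (2 ^ digit_count w m))"
      unfolding inf_branching_min_packing by (rule log2_enat_mono)
    also have "\<dots> = ereal (real (digit_count w m))"
      by (simp add: log2_enat_enat log_nat_power)
    also have "\<dots> \<le> ereal (f u (v - z) + z)"
    proof -
      have "real (digit_count w m) \<le> f m w" using \<open>w \<le> m\<close> by (rule digit_count_bounds)
      also have "\<dots> \<le> f u w + d * (m - u)"
        using branching_class_lipschitz[OF f, of w u m] w m uv d by (simp add: d_def)
      also have "\<dots> \<le> f u w + d * (d + 1)"
        using m d by (intro add_left_mono mult_left_mono) auto
      also have "f u w \<le> f u (v - z)"
        using branching_class_antimono[OF f, of "v - z" w u] w z d dd uv by simp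
      finally show ?thesis using z d by (simp add: algebra_simps)
    qed
    finally show ?thesis by simp
  qed
qed

end

theorem theoremB:
  shows "\<exists>z\<ge>0.
    (\<forall>X :: (real ^ 'n) set. X \<noteq> {} \<longrightarrow>
       (\<exists>f \<in> branching_class (real CARD('n)).
          branching_sim z (\<lambda>u v. ereal (f u v)) (inf_branching X))) \<and>
    (\<forall>f \<in> branching_class (real CARD('n)).
       \<exists>X :: (real ^ 'n) set. X \<noteq> {} \<and>
          branching_sim z (\<lambda>u v. ereal (f u v)) (inf_branching X))"
proof -
  define d where "d = real CARD('n)"
  define z where "z = d * d + 4 * d + 6"
  have d: "0 \<le> d" by (simp add: d_def)
  then have z: "0 \<le> z" "1 \<le> z" "d * (d + 1) \<le> z" by (auto simp: z_def algebra_simps)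
  have "\<exists>f \<in> branching_class d. branching_sim z (\<lambda>u v. ereal (f u v)) (inf_branching X)"
    if "X \<noteq> {}" for X :: "(real ^ 'n) set"
    using inf_branching_sim_branching_class[OF that, of z] z unfolding d_def by simp
  moreover have "\<exists>X :: (real ^ 'n) set. X \<noteq> {} \<and>
      branching_sim z (\<lambda>u v. ereal (f u v)) (inf_branching X)" if "f \<in> branching_class d" for f
  proof -
    have f: "f \<in> branching_class (real CARD('n))" using that by (simp add: d_def)
    have "branching_set f \<noteq> ({} :: (real ^ 'n) set)"
      using piece_nonempty[OF f] by (auto simp: branching_set_def[OF f])
    then show ?thesis using branching_set_sim[OF f, of z] by (auto simp: z_def d_def)
  qed
  ultimately show ?thesis using z(1) unfolding d_def by blast
qed

end
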